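(* Let $\Omega\subseteq\mathbb{C}$ be a domain and let $T=\{T(\lambda):\lambda\in\Omega\}$ be any family of linear operators in a Hilbert space $\mathcal{H}$. For every $\varepsilon>0$ we have $\sigma_{\mathrm{ap},\varepsilon}(T)\subseteq W_\varepsilon(T)$, $$\|T(\lambda)^{-1}\|\le\frac1\varepsilon,\qquad\lambda\in\rho(T)\setminus W_\varepsilon(T),$$ and hence $$\sigma_{\mathrm{ap}}(T)\subseteq W_\Psi(T).$$ If $\sigma(T(\lambda))\subseteq\overline{W(T(\lambda))}$ for all $\lambda\in\Omega$, then $$\sigma(T)\subseteq W_\Psi(T).$$
   Context: $\mathcal{H}$ is a complex Hilbert space; each $T(\lambda)$ is a (possibly unbounded) linear operator in $\mathcal{H}$ with domain $\operatorname{dom}T(\lambda)$. $W(A)=\{(Af,f):f\in\operatorname{dom}A,\|f\|=1\}$ for a linear operator $A$. For the family: $W(T)=\{\lambda\in\Omega:0\in W(T(\lambda))\}$; $W_\varepsilon(T)=\bigcup_{B\in L(\mathcal{H}),\|B\|<\varepsilon}W(T+B)$ for $\varepsilon>0$; $W_\Psi(T)=\bigcap_{\varepsilon>0}W_\varepsilon(T)$ (pseudo numerical range). Spectra of families: $\sigma(T)=\{\lambda\in\Omega:0\in\sigma(T(\lambda))\}$, $\rho(T)=\Omega\setminus\sigma(T)$; $\sigma_{\mathrm{ap}}(T)=\{\lambda\in\Omega:\exists\,(f_n)_n\subseteq\operatorname{dom}T(\lambda),\ \|f_n\|=1,\ T(\lambda)f_n\to0\}$; $\sigma_{\mathrm{ap},\varepsilon}(T)=\{\lambda\in\Omega:\exists\,f\in\operatorname{dom}T(\lambda),\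 \|f\|=1,\ \|T(\lambda)f\|<\varepsilon\}$. *)

theory Defs
  imports "HOL-Analysis.Analysis"
begin

text \<open>
  Complex Hilbert spaces, built on top of the real normed structure of the library.
  The inner product is linear in its first argument.
\<close>

class complex_inner = real_normed_vector +
  fixes scaleC :: "complex \<Rightarrow> 'a \<Rightarrow> 'a" (infixr \<open>*\<^sub>C\<close> 75)
    and cinner :: "'a \<Rightarrow> 'a \<Rightarrow> complex"
  assumes scaleR_scaleC: "r *\<^sub>R x = complex_of_real r *\<^sub>C x"
    and scaleC_add_right: "a *\<^sub>C (x + y) = a *\<^sub>C x + a *\<^sub>C y"
    and scaleC_add_left: "(a + b) *\<^sub>C x = a *\<^sub>C x + b *\<^sub>C x"
    and scaleC_scaleC: "a *\<^sub>C (b *\<^sub>C x) = (a * b) *\<^sub>C x"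
    and scaleC_one: "1 *\<^sub>C x = x"
    and cinner_commute: "cinner x y = cnj (cinner y x)"
    and cinner_add_left: "cinner (x + y) z = cinner x z + cinner y z"
    and cinner_scaleC_left: "cinner (a *\<^sub>C x) y = a * cinner x y"
    and cinner_norm: "cinner x x = complex_of_real ((norm x)\<^sup>2)"

class complex_hilbert = complex_inner + complete_space

instantiation complex :: complex_hilbert
begin

definition scaleC_complex :: "complex \<Rightarrow> complex \<Rightarrow> complex"
  where "scaleC_complex a x = a * x"

definition cinner_complex :: "complex \<Rightarrow> complex \<Rightarrow> complex"
  where "cinner_complex x y = x * cnj y"

instance
proof
  fix x :: complex
  show "cinner x x = complex_of_real ((norm x)\<^sup>2)"
    unfolding cinner_complex_def by (rule complex_norm_square [symmetric])
qed (simp_all add: scaleC_complex_def cinner_complex_def scaleR_conv_of_real distrib_left distrib_right)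

end

text \<open>
  A possibly unbounded operator is a domain together with an action; the values of the
  action outside the domain carry no meaning and are never used below.
\<close>

datatype 'h operator = Operator (op_dom: "'h set") (op_app: "'h \<Rightarrow> 'h")

definition linear_operator :: "'h::complex_inner operator \<Rightarrow> bool" where
  "linear_operator A \<longleftrightarrow>
     0 \<in> op_dom A \<and>
     (\<forall>x\<in>op_dom A. \<forall>y\<in>op_dom A. x + y \<in> op_dom A \<and> op_app A (x + y) = op_app A x + op_app A y) \<and>
     (\<forall>c. \<forall>x\<in>op_dom A. c *\<^sub>C x \<in> op_dom A \<and> op_app A (c *\<^sub>C x) = c *\<^sub>C op_app A x)"

text \<open>Membership in \<open>L(H)\<close>; the operator norm is the library's \<^const>\<open>onorm\<close>.\<close>

definition bounded_clinear :: "('h::complex_inner \<Rightarrow> 'h) \<Rightarrow> bool" where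
  "bounded_clinear B \<longleftrightarrow> bounded_linear B \<and> (\<forall>c x. B (c *\<^sub>C x) = c *\<^sub>C B x)"

definition op_plus :: "'h::complex_inner operator \<Rightarrow> ('h \<Rightarrow> 'h) \<Rightarrow> 'h operator" where
  "op_plus A B = Operator (op_dom A) (\<lambda>x. op_app A x + B x)"

definition op_shift :: "'h::complex_inner operator \<Rightarrow> complex \<Rightarrow> 'h operator" where
  "op_shift A z = Operator (op_dom A) (\<lambda>x. op_app A x - z *\<^sub>C x)"

text \<open>Meaningful only if \<open>A\<close> is a bijection from its domain onto the whole space.\<close>

definition op_inverse :: "'h::complex_inner operator \<Rightarrow> 'h \<Rightarrow> 'h" where
  "op_inverse A = inv_into (op_dom A) (op_app A)"

definition resolvent_set :: "'h::complex_inner operator \<Rightarrow> complex set" where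
  "resolvent_set A =
     {z. bij_betw (op_app (op_shift A z)) (op_dom (op_shift A z)) UNIV \<and>
         bounded_clinear (op_inverse (op_shift A z))}"

definition spectrum :: "'h::complex_inner operator \<Rightarrow> complex set" where
  "spectrum A = - resolvent_set A"

definition numerical_range :: "'h::complex_inner operator \<Rightarrow> complex set" where
  "numerical_range A = {cinner (op_app A f) f | f. f \<in> op_dom A \<and> norm f = 1}"

text \<open>
  A family of operators over \<open>\<Omega>\<close> is a function on all of the complex plane of which only
  the values on \<open>\<Omega>\<close> matter; hence \<open>\<Omega>\<close> is an explicit argument below.
\<close>

definition fam_numerical_range ::
    "complex set \<Rightarrow> (complex \<Rightarrow> 'h::complex_inner operator) \<Rightarrow> complex set" where
  "fam_numerical_range \<Omega> T = {z\<in>\<Omega>. 0 \<in> numerical_range (T z)}"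

definition eps_numerical_range ::
    "complex set \<Rightarrow> (complex \<Rightarrow> 'h::complex_inner operator) \<Rightarrow> real \<Rightarrow> complex set" where
  "eps_numerical_range \<Omega> T \<epsilon> =
     (\<Union>B\<in>{B. bounded_clinear B \<and> onorm B < \<epsilon>}. fam_numerical_range \<Omega> (\<lambda>z. op_plus (T z) B))"

definition pseudo_numerical_range ::
    "complex set \<Rightarrow> (complex \<Rightarrow> 'h::complex_inner operator) \<Rightarrow> complex set" where
  "pseudo_numerical_range \<Omega> T = (\<Inter>\<epsilon>\<in>{0<..}. eps_numerical_range \<Omega> T \<epsilon>)"

definition fam_spectrum ::
    "complex set \<Rightarrow> (complex \<Rightarrow> 'h::complex_inner operator) \<Rightarrow> complex set" where
  "fam_spectrum \<Omega> T = {z\<in>\<Omega>. 0 \<in> spectrum (T z)}"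

definition fam_resolvent_set ::
    "complex set \<Rightarrow> (complex \<Rightarrow> 'h::complex_inner operator) \<Rightarrow> complex set" where
  "fam_resolvent_set \<Omega> T = \<Omega> - fam_spectrum \<Omega> T"

definition fam_ap_spectrum ::
    "complex set \<Rightarrow> (complex \<Rightarrow> 'h::complex_inner operator) \<Rightarrow> complex set" where
  "fam_ap_spectrum \<Omega> T =
     {z\<in>\<Omega>. \<exists>f :: nat \<Rightarrow> 'h. (\<forall>n. f n \<in> op_dom (T z) \<and> norm (f n) = 1) \<and>
                           (\<lambda>n. op_app (T z) (f n)) \<longlonglongrightarrow> 0}"

definition fam_eps_ap_spectrum ::
    "complex set \<Rightarrow> (complex \<Rightarrow> 'h::complex_inner operator) \<Rightarrow> real \<Rightarrow> complex set" where
  "fam_eps_ap_spectrum \<Omega> T \<epsilon> =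
     {z\<in>\<Omega>. \<exists>f\<in>op_dom (T z). norm f = 1 \<and> norm (op_app (T z) f) < \<epsilon>}"

end

theory Submission
  imports Defs
begin

text \<open>
  If \<open>f\<close> is a unit vector in the domain of \<open>T(\<lambda>)\<close> and \<open>c = (T(\<lambda>)f, f)\<close>, then perturbing by the
  scalar operator \<open>B = - c I\<close>, of norm \<open>\<bar>c\<bar>\<close>, gives \<open>((T(\<lambda>) + B) f, f) = 0\<close>.  So \<open>\<lambda>\<close> belongs to
  \<open>W\<^sub>\<epsilon>(T)\<close> as soon as \<open>W(T(\<lambda>))\<close> contains a point of modulus less than \<open>\<epsilon>\<close>.  All the inclusions follow
  from this and Cauchy--Schwarz, and the resolvent bound is the contrapositive of the first one,
  applied to the normalised vector \<open>T(\<lambda>)\<^sup>-\<^sup>1 x\<close>.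
\<close>

lemma scaleC_zero_left: "0 *\<^sub>C x = (0 :: 'a::complex_inner)"
  using scaleC_add_left[of 0 0 x] by simp

lemma cinner_add_right: "cinner (x :: 'a::complex_inner) (y + z) = cinner x y + cinner x z"
  by (simp add: cinner_commute[of x] cinner_add_left)

lemma cinner_scaleC_right: "cinner (x :: 'a::complex_inner) (a *\<^sub>C y) = cnj a * cinner x y"
  by (simp add: cinner_commute[of x] cinner_scaleC_left)

text \<open>The norm of the real structure is homogeneous only for real scalars by axiom; complex
  homogeneity is recovered from \<open>cinner_norm\<close> by comparing squares.\<close>

lemma norm_scaleC: "norm (a *\<^sub>C (x :: 'a::complex_inner)) = cmod a * norm x"
proof -
  have "complex_of_real ((norm (a *\<^sub>C x))\<^sup>2) = (a * cnj a) * cinner x x"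
    by (simp only: cinner_norm[symmetric] cinner_scaleC_left cinner_scaleC_right mult_ac)
  also have "\<dots> = complex_of_real ((cmod a * norm x)\<^sup>2)"
    by (simp only: cinner_norm complex_norm_square[symmetric] power_mult_distrib of_real_mult)
  finally show ?thesis
    by (simp only: of_real_eq_iff power2_eq_iff_nonneg norm_ge_zero mult_nonneg_nonneg)
qed

text \<open>Cauchy-Schwarz. For nonzero \<open>y\<close>, the vector \<open>v\<close> is
  \<open>n\<close> times the component of \<open>x\<close> orthogonal to \<open>y\<close>, scaled so
  that no division occurs. Orthogonality gives \<open>cinner v v = n * cinner v x\<close>, and
  nonnegativity of the left side is the inequality multiplied by \<open>n\<close>.\<close>

lemma norm_cinner_le: "cmod (cinner x y) \<le> norm (x :: 'a::complex_inner) * norm y"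
proof (cases "y = 0")
  case True
  then show ?thesis
    using cinner_add_right[of x 0 0] by simp
next
  case False
  define n where "n = (norm y)\<^sup>2"
  define c where "c = cinner x y"
  define v where "v = complex_of_real n *\<^sub>C x + (- c) *\<^sub>C y"
  have vy: "cinner v y = 0"
    by (simp add: v_def cinner_add_left cinner_scaleC_left cinner_norm n_def c_def)
  have "cinner y x = cnj c"
    unfolding c_def by (rule cinner_commute)
  then have "cinner v x = complex_of_real (n * (norm x)\<^sup>2 - (cmod c)\<^sup>2)"
    by (simp only: v_def cinner_add_left cinner_scaleC_left cinner_norm c_def[symmetric]
        of_real_mult of_real_diff complex_norm_square[of c]) simp
  moreover have "cinner v v = complex_of_real n * cinner v x"
    using cinner_add_right[of v "complex_of_real n *\<^sub>C x" "(- c) *\<^sub>C y"]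
    by (simp add: v_def[symmetric] cinner_scaleC_right vy)
  ultimately have "complex_of_real ((norm v)\<^sup>2) = complex_of_real (n * (n * (norm x)\<^sup>2 - (cmod c)\<^sup>2))"
    by (simp only: cinner_norm of_real_mult)
  \<comment> \<open>Injectivity of \<open>of_real\<close> turns the complex identity into a real one
    whose left side is a square.\<close>
  then have "0 \<le> n * (n * (norm x)\<^sup>2 - (cmod c)\<^sup>2)"
    by (metis of_real_eq_iff zero_le_power2)
  moreover have "n > 0"
    using False by (simp add: n_def)
  ultimately have "(cmod c)\<^sup>2 \<le> (norm x * norm y)\<^sup>2"
    by (simp add: zero_le_mult_iff n_def power_mult_distrib mult.commute)
  then show ?thesis
    unfolding c_def by (rule power2_le_imp_le) simp
qed

lemma bounded_clinear_scaleC: "bounded_clinear (\<lambda>x :: 'a::complex_inner. c *\<^sub>C x)"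
  unfolding bounded_clinear_def
proof (intro conjI allI)
  show "bounded_linear (\<lambda>x :: 'a. c *\<^sub>C x)"
    by (rule bounded_linear_intro[where K = "cmod c"])
      (simp_all add: scaleC_add_right scaleR_scaleC scaleC_scaleC norm_scaleC mult.commute)
qed (simp add: scaleC_scaleC mult.commute)

text \<open>Equality can fail: on the zero space the operator norm is 0 for every
  \<open>c\<close>.\<close>

lemma onorm_scaleC_le: "onorm (\<lambda>x :: 'a::complex_inner. c *\<^sub>C x) \<le> cmod c"
  by (rule onorm_bound) (simp_all add: norm_scaleC)

lemma small_numerical_range_imp_eps_numerical_range:
  assumes "z \<in> \<Omega>" and "w \<in> numerical_range (T z)" and "cmod w < \<epsilon>"
  shows "z \<in> eps_numerical_range \<Omega> T \<epsilon>"
proof -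
  obtain f where f: "f \<in> op_dom (T z)" "norm f = 1" "w = cinner (op_app (T z) f) f"
    using assms(2) by (auto simp: numerical_range_def)
  let ?B = "\<lambda>x. (- w) *\<^sub>C x"
  \<comment> \<open>The second summand contributes \<open>- w * (norm f)^2\<close>, which is
    \<open>- w\<close> because \<open>f\<close> is a unit vector.\<close>
  have "cinner (op_app (T z) f + ?B f) f = 0"
    using f by (simp only: cinner_add_left cinner_scaleC_left cinner_norm) simp
  then have "z \<in> fam_numerical_range \<Omega> (\<lambda>z. op_plus (T z) ?B)"
    using f assms(1)
    by (force simp: fam_numerical_range_def numerical_range_def op_plus_def)
  moreover have "onorm ?B < \<epsilon>"
    using onorm_scaleC_le[of "- w"] assms(3) by (metis norm_minus_cancel order.strict_trans1)
  ultimately show ?thesis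
    unfolding eps_numerical_range_def using bounded_clinear_scaleC by blast
qed

lemma fam_eps_ap_spectrum_subset: "fam_eps_ap_spectrum \<Omega> T \<epsilon> \<subseteq> eps_numerical_range \<Omega> T \<epsilon>"
proof
  fix z assume "z \<in> fam_eps_ap_spectrum \<Omega> T \<epsilon>"
  then obtain f where "z \<in> \<Omega>" and f: "f \<in> op_dom (T z)" "norm f = 1" "norm (op_app (T z) f) < \<epsilon>"
    by (auto simp: fam_eps_ap_spectrum_def)
  moreover have "cinner (op_app (T z) f) f \<in> numerical_range (T z)"
    using f by (auto simp: numerical_range_def)
  moreover have "cmod (cinner (op_app (T z) f) f) < \<epsilon>"
    using norm_cinner_le[of "op_app (T z) f" f] f by simp
  ultimately show "z \<in> eps_numerical_range \<Omega> T \<epsilon>"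
    by (blast intro: small_numerical_range_imp_eps_numerical_range)
qed

text \<open>One sufficiently late member of the approximating sequence is already a witness for the
  given bound.\<close>

lemma fam_ap_spectrum_subset_eps:
  assumes "\<epsilon> > 0"
  shows "fam_ap_spectrum \<Omega> T \<subseteq> fam_eps_ap_spectrum \<Omega> T \<epsilon>"
proof
  fix z assume "z \<in> fam_ap_spectrum \<Omega> T"
  then obtain f :: "nat \<Rightarrow> 'a" where "z \<in> \<Omega>"
    and f: "\<And>n. f n \<in> op_dom (T z)" "\<And>n. norm (f n) = 1"
    and lim: "(\<lambda>n. op_app (T z) (f n)) \<longlonglongrightarrow> 0"
    by (auto simp: fam_ap_spectrum_def)
  obtain n where "norm (op_app (T z) (f n)) < \<epsilon>"
    using LIMSEQ_D[OF lim assms] by auto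
  then show "z \<in> fam_eps_ap_spectrum \<Omega> T \<epsilon>"
    using \<open>z \<in> \<Omega>\<close> f unfolding fam_eps_ap_spectrum_def by blast
qed

lemma onorm_op_inverse_le:
  assumes "\<epsilon> > 0" and "linear_operator A" and bij: "bij_betw (op_app A) (op_dom A) UNIV"
    and below: "\<And>f. f \<in> op_dom A \<Longrightarrow> norm f = 1 \<Longrightarrow> \<epsilon> \<le> norm (op_app A f)"
  shows "onorm (op_inverse A) \<le> 1 / \<epsilon>"
proof (rule onorm_bound)
  fix x
  define y where "y = op_inverse A x"
  have y: "y \<in> op_dom A" "op_app A y = x"
    unfolding y_def op_inverse_def
    using bij by (simp_all add: bij_betw_def inv_into_into f_inv_into_f)
  have "\<epsilon> * norm y \<le> norm x"
  proof (cases "y = 0")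
    case False
    \<comment> \<open>The normalising factor is made complex because \<open>linear_operator\<close>
      states homogeneity for \<open>*\<^sub>C\<close>.\<close>
    define a where "a = complex_of_real (inverse (norm y))"
    have a: "a *\<^sub>C y \<in> op_dom A" "op_app A (a *\<^sub>C y) = a *\<^sub>C x"
      using assms(2) y by (auto simp: linear_operator_def)
    have na: "cmod a = inverse (norm y)"
      by (simp add: a_def norm_inverse)
    then have "\<epsilon> \<le> inverse (norm y) * norm x"
      using below[OF a(1)] a(2) False by (simp add: norm_scaleC)
    then show ?thesis
      using False by (simp add: field_simps)
  qed simp
  then show "norm (op_inverse A x) \<le> 1 / \<epsilon> * norm x"
    using assms(1) by (simp add: y_def field_simps)
qed (use assms(1) in simp)

text \<open>The spectrum is defined through \<open>op_shift\<close>; at 0 the shift subtracts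
  \<open>0 *\<^sub>C x = 0\<close>, so the shifted operator is \<open>T z\<close> itself.\<close>

lemma fam_resolvent_set_bij:
  assumes "z \<in> fam_resolvent_set \<Omega> T"
  shows "z \<in> \<Omega>" and "bij_betw (op_app (T z)) (op_dom (T z)) UNIV"
  using assms
  by (auto simp: fam_resolvent_set_def fam_spectrum_def spectrum_def resolvent_set_def op_shift_def
      scaleC_zero_left)

theorem proposition3p1:
  fixes \<Omega> :: "complex set"
    and T :: "complex \<Rightarrow> 'h::complex_hilbert operator"
  assumes "open \<Omega>" and "connected \<Omega>" and "\<Omega> \<noteq> {}"
    and "\<And>z. z \<in> \<Omega> \<Longrightarrow> linear_operator (T z)"
  shows "(\<forall>\<epsilon>>0. fam_eps_ap_spectrum \<Omega> T \<epsilon> \<subseteq> eps_numerical_range \<Omega> T \<epsilon> \<and>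
            (\<forall>z \<in> fam_resolvent_set \<Omega> T - eps_numerical_range \<Omega> T \<epsilon>.
               onorm (op_inverse (T z)) \<le> 1 / \<epsilon>)) \<and>
         fam_ap_spectrum \<Omega> T \<subseteq> pseudo_numerical_range \<Omega> T \<and>
         ((\<forall>z\<in>\<Omega>. spectrum (T z) \<subseteq> closure (numerical_range (T z))) \<longrightarrow>
            fam_spectrum \<Omega> T \<subseteq> pseudo_numerical_range \<Omega> T)"
proof (intro conjI allI impI ballI)
  show "fam_eps_ap_spectrum \<Omega> T \<epsilon> \<subseteq> eps_numerical_range \<Omega> T \<epsilon>" for \<epsilon>
    by (rule fam_eps_ap_spectrum_subset)
next
  fix \<epsilon> :: real and z
  assume "\<epsilon> > 0" and z: "z \<in> fam_resolvent_set \<Omega> T - eps_numerical_range \<Omega> T \<epsilon>"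
  then have res: "z \<in> fam_resolvent_set \<Omega> T"
    by blast
  note dom = fam_resolvent_set_bij[OF res]
  have "z \<notin> fam_eps_ap_spectrum \<Omega> T \<epsilon>"
    using z fam_eps_ap_spectrum_subset by blast
  then have "\<epsilon> \<le> norm (op_app (T z) f)" if "f \<in> op_dom (T z)" "norm f = 1" for f
    using that dom(1) by (force simp: fam_eps_ap_spectrum_def)
  then show "onorm (op_inverse (T z)) \<le> 1 / \<epsilon>"
    using \<open>\<epsilon> > 0\<close> assms(4)[OF dom(1)] dom(2) by (intro onorm_op_inverse_le)
next
  show "fam_ap_spectrum \<Omega> T \<subseteq> pseudo_numerical_range \<Omega> T"
    unfolding pseudo_numerical_range_def
    by (auto dest: subsetD[OF fam_ap_spectrum_subset_eps] subsetD[OF fam_eps_ap_spectrum_subset])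
next
  assume sp: "\<forall>z\<in>\<Omega>. spectrum (T z) \<subseteq> closure (numerical_range (T z))"
  show "fam_spectrum \<Omega> T \<subseteq> pseudo_numerical_range \<Omega> T"
    unfolding pseudo_numerical_range_def
  proof (intro subsetI INT_I)
    fix z and \<epsilon> :: real
    assume "z \<in> fam_spectrum \<Omega> T" and "\<epsilon> \<in> {0<..}"
    then have "z \<in> \<Omega>" and "0 \<in> closure (numerical_range (T z))" and "\<epsilon> > 0"
      using sp by (auto simp: fam_spectrum_def)
    \<comment> \<open>Having 0 only in the closure is enough, since for each
      \<open>\<epsilon>\<close> a nearby point \<open>w\<close> of the numerical range can be
      shifted to 0 by a perturbation of norm less than \<open>\<epsilon>\<close>.\<close>
    then obtain w where "w \<in> numerical_range (T z)" "cmod w < \<epsilon>"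
      by (auto simp: closure_approachable)
    then show "z \<in> eps_numerical_range \<Omega> T \<epsilon>"
      using \<open>z \<in> \<Omega>\<close> by (blast intro: small_numerical_range_imp_eps_numerical_range)
  qed
qed

end
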